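(* Let $E$ be a row-finite graph and let $F$ be a primitive transfer of $E$. Then the path groupoids are isomorphic (as topological groupoids): $\mathcal{G}_E\cong\mathcal{G}_F$.
   Context: Graphs. A directed graph $E$ consists of a vertex set $E^0$, an edge set $E^1$ and source and range maps $s,r:E^1\to E^0$. Throughout, "graph" means a countable directed graph without multiple edges (at most one edge from $v$ to $w$ for each ordered pair $(v,w)$; loops allowed) which is connected (any two vertices are joined by an undirected path). $E$ is row-finite if every vertex is the source of only finitely many edges. The vertex matrix $B_E$ is the $E^0\times E^0$ matrix with $B_E(v,w)=\#\{e\in E^1: s(e)=v,\ r(e)=w\}$. Primitive transfer. Let $B$ be a (possibly infinite) square 0-1 matrix; write $B_p$ for its $p$-th row and $E_i$ for the row with a $1$ in position $i$ and $0$ elsewhere. Suppose $B_p$ is a nonzero row and $B_p=E_{k_1}+\cdots+E_{k_r}+B_{m_1}+\cdots+B_{m_s}$ for some distinct indices $k_1,\dots,k_r,m_1,\dots,m_s$ (all $r+s$ of them pairwise distinct) with $p\notin\{m_1,\dots,m_s\}$ and no $B_{m_i}$ a zero row. Let $C$ be the matrix which agrees with $B$ outside row $p$, and with $C_{pj}=1$ if $j\in\{k_1,\dots,k_r,m_1,\dots,m_s\}$ and $C_{pj}=0$ otherwise. Then $C$ is a primitive transfer of $B$ (at $p$). A graph $F$ is a primitive transfer of a graph $E$ if the vertex matrix of $F$ is a primitive transfer of the vertex matrix of $E$. Path groupoid. $E^*$ denotes the set of finite paths (including vertices as paths of length $0$), $E^\infty$ the set of infinite paths $x=x_1x_2\cdots$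 (with $r(x_i)=s(x_{i+1})$); $|\alpha|$ is the length of $\alpha\in E^*$. For $x,y\in E^\infty$, $k\in\mathbf{Z}$, write $x\sim_k y$ if $x_i=y_{i-k}$ for all large $i$. Then $\mathcal{G}_E=\{(x,k,y):x\sim_k y\}$ with $(x,k,y)^{-1}=(y,-k,x)$ and $(x,k,y)(y,l,z)=(x,k+l,z)$, with the topology generated by the sets $Z(\alpha,\beta)=\{(\alpha x,|\alpha|-|\beta|,\beta x): x\in E^\infty,\ s(x)=r(\alpha)\}$ for $\alpha,\beta\in E^*$ with $r(\alpha)=r(\beta)$. *)

theory Defs
  imports
    "HOL-Analysis.Product_Topology"
    "HOL-Analysis.Function_Topology"
    "HOL-Library.Omega_Words_Fun"
    "HOL-Library.Countable_Set"
    "Graph_Theory.Arc_Walk"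
    "Graph_Theory.Digraph_Component"
begin

section \<open>Graphs\<close>

text \<open>
  The source and range maps of a graph \<open>G\<close> are \<open>tail G\<close> and \<open>head G\<close>. Connectedness is that of
  the underlying undirected graph; the library notion also excludes the empty graph.
\<close>

definition directed_graph :: "('v, 'e) pre_digraph \<Rightarrow> bool" where
  "directed_graph G \<longleftrightarrow>
     nomulti_digraph G \<and> countable (verts G) \<and> countable (arcs G) \<and>
     Digraph_Component.connected G"

definition row_finite :: "('v, 'e) pre_digraph \<Rightarrow> bool" where
  "row_finite G \<longleftrightarrow> (\<forall>v\<in>verts G. finite (out_arcs G v))"

text \<open>
  A matrix indexed by a set \<open>I\<close> is a function of two arguments, of which only the values on
  \<open>I \<times> I\<close> matter.
\<close>

definition vertex_matrix :: "('v, 'e) pre_digraph \<Rightarrow> 'v \<Rightarrow> 'v \<Rightarrow> nat" where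
  "vertex_matrix G v w = card {e \<in> arcs G. tail G e = v \<and> head G e = w}"


section \<open>Primitive transfer\<close>

definition unit_row :: "'i \<Rightarrow> 'i \<Rightarrow> nat" where
  "unit_row i j = (if j = i then 1 else 0)"

text \<open>
  \<open>K\<close> and \<open>M\<close> are the sets of the indices \<open>k\<^sub>1, \<dots>, k\<^sub>r\<close> and \<open>m\<^sub>1, \<dots>, m\<^sub>s\<close>; since all these
  indices are distinct, finite disjoint sets carry the same information as the two families.
\<close>

definition primitive_transfer_at ::
  "'i set \<Rightarrow> ('i \<Rightarrow> 'i \<Rightarrow> nat) \<Rightarrow> ('i \<Rightarrow> 'i \<Rightarrow> nat) \<Rightarrow> 'i \<Rightarrow> bool" where
  "primitive_transfer_at I B C p \<longleftrightarrow>
     (\<forall>i\<in>I. \<forall>j\<in>I. B i j \<in> {0, 1}) \<and>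
     p \<in> I \<and> (\<exists>j\<in>I. B p j \<noteq> 0) \<and>
     (\<exists>K M. finite K \<and> finite M \<and> K \<subseteq> I \<and> M \<subseteq> I \<and> K \<inter> M = {} \<and> p \<notin> M \<and>
        (\<forall>m\<in>M. \<exists>j\<in>I. B m j \<noteq> 0) \<and>
        (\<forall>j\<in>I. B p j = (\<Sum>k\<in>K. unit_row k j) + (\<Sum>m\<in>M. B m j)) \<and>
        (\<forall>i\<in>I - {p}. \<forall>j\<in>I. C i j = B i j) \<and>
        (\<forall>j\<in>I. C p j = (if j \<in> K \<union> M then 1 else 0)))"

definition matrix_primitive_transfer ::
  "'i set \<Rightarrow> ('i \<Rightarrow> 'i \<Rightarrow> nat) \<Rightarrow> ('i \<Rightarrow> 'i \<Rightarrow> nat) \<Rightarrow> bool" where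
  "matrix_primitive_transfer I B C \<longleftrightarrow> (\<exists>p. primitive_transfer_at I B C p)"

text \<open>The two vertex matrices have the same index set, so the graphs have the same vertices.\<close>

definition graph_primitive_transfer ::
  "('v, 'e) pre_digraph \<Rightarrow> ('v, 'f) pre_digraph \<Rightarrow> bool" where
  "graph_primitive_transfer E F \<longleftrightarrow>
     verts F = verts E \<and>
     matrix_primitive_transfer (verts E) (vertex_matrix E) (vertex_matrix F)"


section \<open>Topological groupoids\<close>

text \<open>
  \<open>gmult\<close> is only meaningful on the set \<open>gcomposable\<close> of composable pairs, \<open>ginv\<close> on \<open>gcarrier\<close>.
\<close>

record 'g top_groupoid =
  gcarrier :: "'g set"
  gcomposable :: "('g \<times> 'g) set"
  gmult :: "'g \<Rightarrow> 'g \<Rightarrow> 'g"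
  ginv :: "'g \<Rightarrow> 'g"
  gtopology :: "'g topology"

definition top_groupoid_iso ::
  "'g top_groupoid \<Rightarrow> 'h top_groupoid \<Rightarrow> ('g \<Rightarrow> 'h) \<Rightarrow> bool" where
  "top_groupoid_iso G H \<phi> \<longleftrightarrow>
     bij_betw \<phi> (gcarrier G) (gcarrier H) \<and>
     (\<forall>g\<in>gcarrier G. \<forall>h\<in>gcarrier G.
        (g, h) \<in> gcomposable G \<longleftrightarrow> (\<phi> g, \<phi> h) \<in> gcomposable H) \<and>
     (\<forall>(g, h)\<in>gcomposable G. \<phi> (gmult G g h) = gmult H (\<phi> g) (\<phi> h)) \<and>
     (\<forall>g\<in>gcarrier G. \<phi> (ginv G g) = ginv H (\<phi> g)) \<and>
     homeomorphic_map (gtopology G) (gtopology H) \<phi>"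

definition top_groupoid_isomorphic :: "'g top_groupoid \<Rightarrow> 'h top_groupoid \<Rightarrow> bool" where
  "top_groupoid_isomorphic G H \<longleftrightarrow> (\<exists>\<phi>. top_groupoid_iso G H \<phi>)"


section \<open>The path groupoid\<close>

text \<open>
  A finite path is given by its source, its list of edges and its range; \<open>(v, [], v)\<close> is the path
  of length \<open>0\<close> at the vertex \<open>v\<close>.
\<close>

definition finite_paths :: "('v, 'e) pre_digraph \<Rightarrow> ('v \<times> 'e list \<times> 'v) set" where
  "finite_paths G = {(u, as, v). pre_digraph.awalk G u as v}"

definition path_edges :: "'v \<times> 'e list \<times> 'v \<Rightarrow> 'e list" where
  "path_edges \<alpha> = fst (snd \<alpha>)"

definition path_range :: "'v \<times> 'e list \<times> 'v \<Rightarrow> 'v" where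
  "path_range \<alpha> = snd (snd \<alpha>)"

definition path_length :: "'v \<times> 'e list \<times> 'v \<Rightarrow> nat" where
  "path_length \<alpha> = length (path_edges \<alpha>)"

text \<open>The edges of an infinite path are indexed from \<open>0\<close> instead of \<open>1\<close>.\<close>

definition infinite_paths :: "('v, 'e) pre_digraph \<Rightarrow> 'e word set" where
  "infinite_paths G =
     {x. (\<forall>i. x i \<in> arcs G) \<and> (\<forall>i. head G (x i) = tail G (x (Suc i)))}"

text \<open>
  The relation \<open>x \<sim>\<^sub>k y\<close>; it is unaffected by the indexing from \<open>0\<close>, and the truncation by \<open>nat\<close>
  concerns only finitely many \<open>i\<close>.
\<close>

definition tail_equiv :: "int \<Rightarrow> 'e word \<Rightarrow> 'e word \<Rightarrow> bool" where
  "tail_equiv k x y \<longleftrightarrow> (\<forall>\<^sub>F i in sequentially. x i = y (nat (int i - k)))"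

definition path_groupoid_carrier ::
  "('v, 'e) pre_digraph \<Rightarrow> ('e word \<times> int \<times> 'e word) set" where
  "path_groupoid_carrier G =
     {(x, k, y). x \<in> infinite_paths G \<and> y \<in> infinite_paths G \<and> tail_equiv k x y}"

definition cylinder ::
  "('v, 'e) pre_digraph \<Rightarrow> 'v \<times> 'e list \<times> 'v \<Rightarrow> 'v \<times> 'e list \<times> 'v \<Rightarrow>
     ('e word \<times> int \<times> 'e word) set" where
  "cylinder G \<alpha> \<beta> =
     {(path_edges \<alpha> \<frown> x, int (path_length \<alpha>) - int (path_length \<beta>), path_edges \<beta> \<frown> x) | x.
        x \<in> infinite_paths G \<and> tail G (x 0) = path_range \<alpha>}"

definition path_groupoid_topology ::
  "('v, 'e) pre_digraph \<Rightarrow> ('e word \<times> int \<times> 'e word) topology" where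
  "path_groupoid_topology G =
     topology_generated_by
       {cylinder G \<alpha> \<beta> | \<alpha> \<beta>.
          \<alpha> \<in> finite_paths G \<and> \<beta> \<in> finite_paths G \<and> path_range \<alpha> = path_range \<beta>}"

definition path_groupoid ::
  "('v, 'e) pre_digraph \<Rightarrow> ('e word \<times> int \<times> 'e word) top_groupoid" where
  "path_groupoid G =
     \<lparr> gcarrier = path_groupoid_carrier G,
       gcomposable =
         {((x, k, y), (y', l, z)). (x, k, y) \<in> path_groupoid_carrier G \<and>
            (y', l, z) \<in> path_groupoid_carrier G \<and> y = y'},
       gmult = (\<lambda>(x, k, y) (y', l, z). (x, k + l, z)),
       ginv = (\<lambda>(x, k, y). (y, - k, x)),
       gtopology = path_groupoid_topology G \<rparr>"

end

theory Submission
  imports Defs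
begin

text \<open>
  The rows \<open>B\<^sub>m\<close> with \<open>m \<in> M\<close> and the set \<open>K\<close> partition the successors of \<open>p\<close> in \<open>E\<close>. So an edge
  of \<open>E\<close> from \<open>p\<close> to a vertex \<open>j \<notin> K\<close> determines a unique \<open>m \<in> M\<close> with an edge from \<open>m\<close> to \<open>j\<close>, and
  it is coded by the path \<open>p \<rightarrow> m \<rightarrow> j\<close> of \<open>F\<close>; every other edge is coded by the edge of \<open>F\<close> with the
  same ends. Since \<open>p \<notin> M\<close>, every infinite path of \<open>F\<close> is cut into code words in exactly one way, so
  coding is a bijection \<open>x \<mapsto> \<theta>(x)\<close> of the infinite paths. It induces
  \<open>(\<alpha>x, |\<alpha>| - |\<beta>|, \<beta>x) \<mapsto> (\<theta>(\<alpha>)\<theta>(x), |\<theta>(\<alpha>)| - |\<theta>(\<beta>)|, \<theta>(\<beta>)\<theta>(x))\<close>, which maps \<open>Z(\<alpha>,\<beta>)\<close> onto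
  \<open>Z(\<theta>(\<alpha>),\<theta>(\<beta>))\<close>.
\<close>

section \<open>Infinite paths\<close>

context wf_digraph
begin

lemma infinite_paths_in_arcs: "x \<in> infinite_paths G \<Longrightarrow> x i \<in> arcs G"
  by (simp add: infinite_paths_def)

lemma infinite_paths_suffix: "x \<in> infinite_paths G \<Longrightarrow> suffix n x \<in> infinite_paths G"
  by (simp add: infinite_paths_def)

lemma infinite_paths_build_iff:
  "e ## x \<in> infinite_paths G \<longleftrightarrow>
     e \<in> arcs G \<and> head G e = tail G (x 0) \<and> x \<in> infinite_paths G"
proof -
  have all_nat: "(\<forall>i. P i) \<longleftrightarrow> P 0 \<and> (\<forall>i. P (Suc i))" for P :: "nat \<Rightarrow> bool"
    by (metis nat.exhaust)
  show ?thesis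
    unfolding infinite_paths_def mem_Collect_eq
    by (subst (1 2) all_nat) auto
qed

lemma tail_conc_0:
  assumes "awalk u as (tail G (x 0))"
  shows "tail G ((as \<frown> x) 0) = u"
  using assms by (cases as) (auto simp: awalk_simps)

text \<open>Reading the source off the whole word covers empty \<open>as\<close> as well: the walk
  then starts at the source of \<open>x\<close>.\<close>

lemma infinite_paths_conc_iff:
  "as \<frown> x \<in> infinite_paths G \<longleftrightarrow>
     awalk (tail G ((as \<frown> x) 0)) as (tail G (x 0)) \<and> x \<in> infinite_paths G"
proof (induction as)
  case Nil
  then show ?case
    by (auto simp: awalk_Nil_iff infinite_paths_in_arcs)
next
  case (Cons a as)
  then show ?case
    using tail_conc_0[of "head G a" as x]
    by (auto simp: awalk_Cons_iff infinite_paths_build_iff)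
qed

lemma infinite_paths_conc:
  assumes "awalk u as (tail G (x 0))" "x \<in> infinite_paths G"
  shows "as \<frown> x \<in> infinite_paths G"
  using assms tail_conc_0 by (simp add: infinite_paths_conc_iff)

lemma awalk_prefix:
  assumes "x \<in> infinite_paths G"
  shows "awalk (tail G (x 0)) (prefix n x) (tail G (x n))"
  using infinite_paths_conc_iff[of "prefix n x" "suffix n x"] assms
  by (simp del: subsequence_shift)

lemma path_groupoid_carrierI:
  assumes "awalk u as (tail G (z 0))" "awalk w bs (tail G (z 0))" "z \<in> infinite_paths G"
  shows "(as \<frown> z, int (length as) - int (length bs), bs \<frown> z) \<in> path_groupoid_carrier G"
proof -
  have "(as \<frown> z) i = (bs \<frown> z) (nat (int i - (int (length as) - int (length bs))))"
    if "i \<ge> length as" for i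
  proof -
    have "nat (int i - (int (length as) - int (length bs))) = length bs + (i - length as)"
      using that by linarith
    then show ?thesis
      using that by simp
  qed
  then have "tail_equiv (int (length as) - int (length bs)) (as \<frown> z) (bs \<frown> z)"
    unfolding tail_equiv_def eventually_sequentially by blast
  then show ?thesis
    using assms infinite_paths_conc by (auto simp: path_groupoid_carrier_def)
qed

text \<open>Far enough out, the suffix of \<open>x\<close> from \<open>n\<close> and that of
  \<open>y\<close> from \<open>n - k\<close> coincide; this suffix is the common tail
  \<open>z\<close>.\<close>

lemma path_groupoid_carrierE:
  assumes "(x, k, y) \<in> path_groupoid_carrier G"
  obtains u as w bs z where
    "awalk u as (tail G (z 0))" "awalk w bs (tail G (z 0))" "z \<in> infinite_paths G"
    "x = as \<frown> z" "y = bs \<frown> z" "k = int (length as) - int (length bs)"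
proof -
  have x: "x \<in> infinite_paths G" and y: "y \<in> infinite_paths G" and "tail_equiv k x y"
    using assms by (auto simp: path_groupoid_carrier_def)
  then obtain n0 where n0: "x i = y (nat (int i - k))" if "i \<ge> n0" for i
    unfolding tail_equiv_def eventually_sequentially by blast
  \<comment> \<open>The bound \<open>nat k\<close> keeps \<open>n - k\<close> nonnegative, so the
    truncation in \<open>m\<close> is exact.\<close>
  define n where "n = max n0 (nat k)"
  define m where "m = nat (int n - k)"
  have m: "int m = int n - k"
    unfolding m_def n_def by linarith
  have "x (n + i) = y (m + i)" for i
  proof -
    have "nat (int (n + i) - k) = m + i"
      using m by linarith
    then show ?thesis
      using n0[of "n + i"] by (simp add: n_def)
  qed
  then have suffix: "suffix n x = suffix m y"
    by (simp add: suffix_def)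
  have "awalk (tail G (x 0)) (prefix n x) (tail G (suffix n x 0))"
    using awalk_prefix[OF x, of n] by simp
  moreover have "awalk (tail G (y 0)) (prefix m y) (tail G (suffix n x 0))"
    using awalk_prefix[OF y, of m] by (simp add: suffix)
  moreover have "y = prefix m y \<frown> suffix n x"
    by (simp add: suffix)
  ultimately show thesis
    using that[of "tail G (x 0)" "prefix n x" "suffix n x" "tail G (y 0)" "prefix m y"]
      infinite_paths_suffix[OF x] m by simp
qed

section \<open>The basic open sets of the path groupoid\<close>

definition cylinders where
  "cylinders =
     {cylinder G \<alpha> \<beta> | \<alpha> \<beta>.
        \<alpha> \<in> finite_paths G \<and> \<beta> \<in> finite_paths G \<and> path_range \<alpha> = path_range \<beta>}"

lemma cylinder_eq:
  "cylinder G (u, as, v) (w, bs, v') =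
     {(as \<frown> x, int (length as) - int (length bs), bs \<frown> x) | x.
        x \<in> infinite_paths G \<and> tail G (x 0) = v}"
  by (simp add: cylinder_def path_edges_def path_length_def path_range_def)

lemma cylinders_eq:
  "cylinders = {cylinder G (u, as, v) (w, bs, v) | u as v w bs. awalk u as v \<and> awalk w bs v}"
  by (simp add: cylinders_def finite_paths_def path_range_def)

text \<open>A generated topology lives on the union of its generators, so this identifies the
  carrier as the underlying space.\<close>

lemma Union_cylinders: "\<Union>cylinders = path_groupoid_carrier G"
proof (intro equalityI subsetI)
  fix g assume "g \<in> \<Union>cylinders"
  then show "g \<in> path_groupoid_carrier G"
    by (auto simp: cylinders_eq cylinder_eq intro: path_groupoid_carrierI)
next
  fix g assume g: "g \<in> path_groupoid_carrier G"
  obtain x k y where xky: "g = (x, k, y)"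
    by (cases g)
  obtain u as w bs z where *:
    "awalk u as (tail G (z 0))" "awalk w bs (tail G (z 0))" "z \<in> infinite_paths G"
    "x = as \<frown> z" "y = bs \<frown> z" "k = int (length as) - int (length bs)"
    using g unfolding xky by (rule path_groupoid_carrierE)
  then have "g \<in> cylinder G (u, as, tail G (z 0)) (w, bs, tail G (z 0))"
    by (auto simp: xky cylinder_eq)
  then show "g \<in> \<Union>cylinders"
    using * unfolding cylinders_eq by blast
qed

lemma path_groupoid_topology_eq: "path_groupoid_topology G = topology_generated_by cylinders"
  by (simp add: path_groupoid_topology_def cylinders_def)

end

lemma homeomorphic_map_generated:
  assumes inj: "inj_on f (\<Union>S)" and image: "f ` \<Union>S = \<Union>T"
    and openin_image: "\<And>U. U \<in> S \<Longrightarrow> openin (topology_generated_by T) (f ` U)"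
    and openin_preimage:
      "\<And>V. V \<in> T \<Longrightarrow> openin (topology_generated_by S) {x \<in> \<Union>S. f x \<in> V}"
  shows "homeomorphic_map (topology_generated_by S) (topology_generated_by T) f"
proof -
  define g where "g = inv_into (\<Union>S) f"
  have g_f: "g (f x) = x" if "x \<in> \<Union>S" for x
    unfolding g_def by (rule inv_into_f_f[OF inj that])
  have f_g: "f (g y) = y" if "y \<in> \<Union>T" for y
    unfolding g_def using that image by (intro f_inv_into_f) simp
  have g_in: "g y \<in> \<Union>S" if "y \<in> \<Union>T" for y
    unfolding g_def using that image by (intro inv_into_into) simp
  have "continuous_map (topology_generated_by S) (topology_generated_by T) f"
    unfolding continuous_on_generated_topo_iff topology_generated_by_topspace
  proof (intro conjI allI impI)
    fix V assume "V \<in> T"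
    moreover have "f -` V \<inter> \<Union>S = {x \<in> \<Union>S. f x \<in> V}"
      by blast
    ultimately show "openin (topology_generated_by S) (f -` V \<inter> \<Union>S)"
      using openin_preimage by simp
  qed (simp add: image)
  moreover have "continuous_map (topology_generated_by T) (topology_generated_by S) g"
    unfolding continuous_on_generated_topo_iff topology_generated_by_topspace
  proof (intro conjI allI impI)
    fix U assume U: "U \<in> S"
    have "g -` U \<inter> \<Union>T = f ` U"
    proof (intro equalityI subsetI)
      fix y assume "y \<in> g -` U \<inter> \<Union>T"
      then show "y \<in> f ` U"
        using f_g[of y] by (metis Int_iff image_eqI vimageE)
    next
      fix y assume "y \<in> f ` U"
      then obtain x where x: "x \<in> U" "y = f x"
        by blast
      then have "x \<in> \<Union>S"
        using U by blast
      moreover from this have "f x \<in> \<Union>T"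
        using image by blast
      ultimately show "y \<in> g -` U \<inter> \<Union>T"
        using x g_f by simp
    qed
    then show "openin (topology_generated_by T) (g -` U \<inter> \<Union>T)"
      using openin_image[OF U] by simp
  qed (use g_in in blast)
  ultimately have "homeomorphic_maps (topology_generated_by S) (topology_generated_by T) f g"
    using g_f f_g by (simp add: homeomorphic_maps_def)
  then show ?thesis
    by (rule homeomorphic_maps_map[THEN iffD1, THEN conjunct1])
qed


section \<open>Path codes\<close>

text \<open>\<open>a\<close> and \<open>b\<close> are both the first entry outside \<open>S\<close>
  of the same list.\<close>

lemma first_not_in_unique:
  assumes "as @ a # cs = bs @ b # ds"
    and "set as \<subseteq> S" "a \<notin> S" "set bs \<subseteq> S" "b \<notin> S"
  shows "as = bs \<and> a = b"
  using assms
proof (induction as arbitrary: bs)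
  case Nil
  then show ?case by (cases bs) auto
next
  case (Cons c as)
  then show ?case by (cases bs) auto
qed

text \<open>
  Since exactly the last edge of a code word lies outside \<open>mid\<close>, the places where an infinite path
  of \<open>F\<close> is cut into code words can be recognised locally. Two tail equivalent paths are therefore
  cut at the same places of a common tail.
\<close>

locale path_code = E: wf_digraph E + F: wf_digraph F
  for E :: "('v, 'e) pre_digraph" and F :: "('v, 'f) pre_digraph" +
  fixes code :: "'e \<Rightarrow> 'f list" and mid :: "'f set"
  assumes verts_eq: "verts F = verts E"
    and code_awalk: "e \<in> arcs E \<Longrightarrow> F.awalk (tail E e) (code e) (head E e)"
    and code_nonempty: "e \<in> arcs E \<Longrightarrow> code e \<noteq> []"
    and code_butlast: "e \<in> arcs E \<Longrightarrow> set (butlast (code e)) \<subseteq> mid"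
    and code_last: "e \<in> arcs E \<Longrightarrow> last (code e) \<notin> mid"
    and code_inj: "inj_on code (arcs E)"
    and code_parse:
      "F.awalk u as v \<Longrightarrow> as \<noteq> [] \<Longrightarrow> last as \<notin> mid \<Longrightarrow> \<exists>e\<in>arcs E. \<exists>bs. as = code e @ bs"
    and code_recurrent: "y \<in> infinite_paths F \<Longrightarrow> \<exists>i. y i \<notin> mid"
begin

text \<open>The last edge of a code word is its first edge outside \<open>mid\<close>, so the word
  can be read off any list that it begins; \<open>code\<close> is injective.\<close>

lemma code_prefix_free:
  assumes "e \<in> arcs E" "e' \<in> arcs E" "code e @ as = code e' @ bs"
  shows "e = e'"
proof -
  have split: "code d = butlast (code d) @ [last (code d)]" if "d \<in> arcs E" for d
    using code_nonempty[OF that] by simp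
  have "butlast (code e) @ last (code e) # as = butlast (code e') @ last (code e') # bs"
    using assms(3) split[OF assms(1)] split[OF assms(2)]
    by (metis append.assoc append_Cons append_Nil)
  then have "code e = code e'"
    using first_not_in_unique code_butlast code_last assms split by metis
  then show ?thesis
    using assms code_inj by (simp add: inj_on_eq_iff)
qed

lemma code_prefix_free_conc:
  assumes "e \<in> arcs E" "e' \<in> arcs E" "code e \<frown> x = code e' \<frown> y"
  shows "e = e'"
proof -
  \<comment> \<open>This prefix is long enough to contain both code words, which reduces the claim
    to lists.\<close>
  define n where "n = length (code e) + length (code e')"
  have "prefix n (code e \<frown> x) = prefix n (code e' \<frown> y)"
    using assms(3) by simp
  then have "code e @ prefix (n - length (code e)) x = code e' @ prefix (n - length (code e')) y"
    by (simp add: n_def)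
  then show ?thesis
    using code_prefix_free assms by blast
qed

section \<open>Encoding and decoding of finite paths\<close>

definition encode :: "'e list \<Rightarrow> 'f list" where
  "encode as = concat (map code as)"

lemma encode_simps [simp]:
  "encode [] = []"
  "encode (a # as) = code a @ encode as"
  "encode (as @ bs) = encode as @ encode bs"
  by (simp_all add: encode_def)

lemma encode_awalk: "E.awalk u as v \<Longrightarrow> F.awalk u (encode as) v"
proof (induction as arbitrary: u)
  case Nil
  then show ?case
    by (auto simp: E.awalk_Nil_iff F.awalk_Nil_iff verts_eq)
next
  case (Cons a as)
  then have "F.awalk u (code a) (head E a)" "F.awalk (head E a) (encode as) v"
    using code_awalk by (auto simp: E.awalk_Cons_iff)
  then show ?case
    using F.awalk_appendI by simp
qed

lemma length_encode: "set as \<subseteq> arcs E \<Longrightarrow> length as \<le> length (encode as)"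
proof (induction as)
  case (Cons a as)
  then have "length (code a) \<ge> 1"
    using code_nonempty by (simp add: Suc_le_eq)
  then show ?case
    using Cons by simp
qed simp

text \<open>Peeling off the first code word leaves a shorter walk that is empty or still ends
  outside \<open>mid\<close>, so induction on the length applies.\<close>

lemma decode:
  assumes "F.awalk u as v" "as = [] \<or> last as \<notin> mid"
  shows "\<exists>bs. E.awalk u bs v \<and> encode bs = as"
  using assms
proof (induction as arbitrary: u rule: length_induct)
  case (1 as)
  show ?case
  proof (cases "as = []")
    case True
    then show ?thesis
      using 1(2) by (intro exI[of _ "[]"]) (auto simp: E.awalk_Nil_iff F.awalk_Nil_iff verts_eq)
  next
    case False
    then have "last as \<notin> mid"
      using 1(3) by simp
    then obtain e cs where e: "e \<in> arcs E" and as: "as = code e @ cs"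
      using code_parse[OF 1(2) False] by metis
    obtain w where w: "F.awalk u (code e) w" "F.awalk w cs v"
      using 1(2) unfolding as by (meson F.awalk_append_iff)
    \<comment> \<open>A nonempty edge list determines both ends of its walk.\<close>
    have "w = head E e" "u = tail E e"
      using F.awalk_ends[OF w(1) code_awalk[OF e]] code_nonempty[OF e] by auto
    moreover have "cs = [] \<or> last cs \<notin> mid"
      using 1(3) as by auto
    moreover have "length cs < length as"
      using code_nonempty[OF e] as by simp
    ultimately obtain bs where "E.awalk (head E e) bs v" "encode bs = cs"
      using 1(1) w(2) by blast
    then show ?thesis
      using e as \<open>u = tail E e\<close> by (intro exI[of _ "e # bs"]) (simp add: E.awalk_Cons_iff)
  qed
qed

section \<open>Coding of infinite paths\<close>

text \<open>Code words are nonempty, so the encoding of the first \<open>Suc i\<close> edges is long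
  enough to have an entry \<open>i\<close>.\<close>

definition lift :: "'e word \<Rightarrow> 'f word" where
  "lift x i = encode (prefix (Suc i) x) ! i"

lemma length_encode_prefix:
  assumes "x \<in> infinite_paths E"
  shows "n \<le> length (encode (prefix n x))"
proof -
  have "set (prefix n x) \<subseteq> arcs E"
    using E.infinite_paths_in_arcs[OF assms] by auto
  from length_encode[OF this] show ?thesis
    by simp
qed

text \<open>Lengthening a prefix only extends its encoding; both sides are compared with the prefix
  of length \<open>Suc i + n\<close>.\<close>

lemma lift_nth:
  assumes x: "x \<in> infinite_paths E" and i: "i < length (encode (prefix n x))"
  shows "lift x i = encode (prefix n x) ! i"
proof -
  have prefix_nth: "encode (prefix (m + d) x) ! i = encode (prefix m x) ! i"
    if "i < length (encode (prefix m x))" for m d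
    using that by (simp add: subsequence_append nth_append)
  have "i < length (encode (prefix (Suc i) x))"
    using length_encode_prefix[OF x, of "Suc i"] by simp
  then have "lift x i = encode (prefix (Suc i + n) x) ! i"
    unfolding lift_def by (rule prefix_nth[symmetric])
  also have "\<dots> = encode (prefix n x) ! i"
    using prefix_nth[OF i, of "Suc i"] by (simp only: add.commute)
  finally show ?thesis .
qed

lemma lift_conc:
  assumes "as \<frown> x \<in> infinite_paths E"
  shows "lift (as \<frown> x) = encode as \<frown> lift x"
proof
  fix i
  have x: "x \<in> infinite_paths E"
    using assms E.infinite_paths_conc_iff by blast
  show "lift (as \<frown> x) i = (encode as \<frown> lift x) i"
  proof (cases "i < length (encode as)")
    case True
    then show ?thesis
      using lift_nth[OF assms, of i "length as"] by simp
  next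
    case False
    define j where "j = i - length (encode as)"
    have i: "i = length (encode as) + j"
      using False by (simp add: j_def)
    have pre: "prefix (length as + Suc j) (as \<frown> x) = as @ prefix (Suc j) x"
      by (subst prefix_conc_snd) simp_all
    have "lift (as \<frown> x) i = encode (prefix (length as + Suc j) (as \<frown> x)) ! i"
      using length_encode_prefix[OF x, of "Suc j"]
      by (intro lift_nth[OF assms]) (simp add: pre i del: subseq_to_Suc)
    also have "\<dots> = lift x j"
      by (simp add: pre i lift_def nth_append del: subseq_to_Suc)
    finally show ?thesis
      by (simp add: i)
  qed
qed

lemma lift_prefix_suffix:
  assumes "x \<in> infinite_paths E"
  shows "lift x = encode (prefix n x) \<frown> lift (suffix n x)"
  using lift_conc[of "prefix n x" "suffix n x"] assms by simp

lemma tail_lift: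
  assumes "x \<in> infinite_paths E"
  shows "tail F (lift x 0) = tail E (x 0)"
proof -
  have "x 0 \<in> arcs E"
    using assms E.infinite_paths_in_arcs by blast
  then have "F.awalk (tail E (x 0)) (code (x 0)) (head E (x 0))" "code (x 0) \<noteq> []"
    using code_awalk code_nonempty by auto
  then show ?thesis
    by (cases "code (x 0)") (auto simp: lift_def F.awalk_Cons_iff)
qed

lemma lift_in_infinite_paths:
  assumes x: "x \<in> infinite_paths E"
  shows "lift x \<in> infinite_paths F"
proof -
  have "lift x i \<in> arcs F \<and> head F (lift x i) = tail F (lift x (Suc i))" for i
  proof -
    \<comment> \<open>A walk long enough to show the two consecutive edges \<open>i\<close> and
      \<open>Suc i\<close> of \<open>lift x\<close>.\<close>
    define as where "as = encode (prefix (Suc (Suc i)) x)"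
    have "F.awalk (tail E (x 0)) as (tail E (x (Suc (Suc i))))"
      unfolding as_def by (intro encode_awalk E.awalk_prefix x)
    moreover have len: "Suc i < length as"
      using length_encode_prefix[OF x, of "Suc (Suc i)"] by (simp add: as_def)
    moreover have "as = take i as @ as ! i # as ! Suc i # drop (Suc (Suc i)) as"
      using len by (simp add: Cons_nth_drop_Suc)
    ultimately have "as ! i \<in> arcs F \<and> head F (as ! i) = tail F (as ! Suc i)"
      by (metis F.awalk_append_iff F.awalk_Cons_iff)
    moreover have "lift x i = as ! i" "lift x (Suc i) = as ! Suc i"
      using lift_nth[OF x, of _ "Suc (Suc i)", folded as_def] len by simp_all
    ultimately show ?thesis
      by simp
  qed
  then show ?thesis
    by (simp add: infinite_paths_def)
qed

text \<open>Prefix-freeness yields equal first edges; cancelling their common code word passes to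
  the suffixes, so the induction on \<open>i\<close> varies \<open>x\<close> and
  \<open>y\<close>.\<close>

lemma lift_inj: "inj_on lift (infinite_paths E)"
proof (rule inj_onI, rule ext)
  fix x y i
  assume "x \<in> infinite_paths E" "y \<in> infinite_paths E" "lift x = lift y"
  then show "x i = y i"
  proof (induction i arbitrary: x y)
    case (0 x y)
    then show ?case
      using lift_prefix_suffix[of x 1] lift_prefix_suffix[of y 1]
      by (auto intro: code_prefix_free_conc E.infinite_paths_in_arcs)
  next
    case (Suc i x y)
    have eq: "code (x 0) \<frown> lift (suffix 1 x) = code (y 0) \<frown> lift (suffix 1 y)"
      using Suc.prems lift_prefix_suffix[of x 1] lift_prefix_suffix[of y 1] by simp
    then have "x 0 = y 0"
      using Suc.prems by (auto intro: code_prefix_free_conc E.infinite_paths_in_arcs)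
    then have "lift (suffix 1 x) = lift (suffix 1 y)"
      using eq by simp
    then show ?case
      using Suc.IH[OF E.infinite_paths_suffix E.infinite_paths_suffix] Suc.prems(1,2)
      by (metis suffix_nth plus_1_eq_Suc)
  qed
qed

text \<open>An edge outside \<open>mid\<close> completes a code word, so the path may be cut just
  after it.\<close>

lemma infinite_path_split:
  assumes y: "y \<in> infinite_paths F"
  obtains i where
    "F.awalk (tail F (y 0)) (prefix (Suc i) y) (tail F (suffix (Suc i) y 0))"
    "last (prefix (Suc i) y) \<notin> mid"
proof -
  obtain i where "y i \<notin> mid"
    using code_recurrent[OF y] by blast
  moreover have "F.awalk (tail F (y 0)) (prefix (Suc i) y) (tail F (suffix (Suc i) y 0))"
    using F.awalk_prefix[OF y, of "Suc i"] by simp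
  ultimately show thesis
    using that by simp
qed

lemma infinite_path_parse:
  assumes y: "y \<in> infinite_paths F"
  shows "\<exists>e z. e \<in> arcs E \<and> z \<in> infinite_paths F \<and> y = code e \<frown> z \<and> tail F (z 0) = head E e"
proof -
  obtain i where
    i: "F.awalk (tail F (y 0)) (prefix (Suc i) y) (tail F (suffix (Suc i) y 0))"
      "last (prefix (Suc i) y) \<notin> mid"
    using y by (rule infinite_path_split)
  then obtain e bs where e: "e \<in> arcs E" and bs: "prefix (Suc i) y = code e @ bs"
    using code_parse[OF i(1)] by auto
  define z where "z = bs \<frown> suffix (Suc i) y"
  have yz: "y = code e \<frown> z"
    unfolding z_def conc_conc bs[symmetric] by simp
  have z: "F.awalk (tail F ((code e \<frown> z) 0)) (code e) (tail F (z 0))" "z \<in> infinite_paths F"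
    using y unfolding yz F.infinite_paths_conc_iff by auto
  have "tail F (z 0) = head E e"
    using F.awalk_ends[OF z(1) code_awalk[OF e]] code_nonempty[OF e] by auto
  then show ?thesis
    using e z(2) yz by blast
qed

lemma lift_surj:
  assumes y: "y \<in> infinite_paths F"
  shows "y \<in> lift ` infinite_paths E"
proof -
  \<comment> \<open>A choice of parse for every path: \<open>d z\<close> is the edge coded first and
    \<open>r z\<close> the remaining path. Iterating \<open>r\<close> decodes \<open>y\<close> edge
    by edge.\<close>
  obtain d r where dr:
    "d z \<in> arcs E \<and> r z \<in> infinite_paths F \<and> z = code (d z) \<frown> r z \<and>
       tail F (r z 0) = head E (d z)" if "z \<in> infinite_paths F" for z
    using infinite_path_parse by metis
  define x where "x n = d ((r ^^ n) y)" for n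
  have r: "(r ^^ n) y \<in> infinite_paths F" for n
    by (induction n) (use y dr in auto)
  have head: "head E (d z) = tail E (d (r z))" if z: "z \<in> infinite_paths F" for z
  proof -
    have rz: "r z \<in> infinite_paths F" "d (r z) \<in> arcs E" "r z = code (d (r z)) \<frown> r (r z)"
      using dr[OF z] dr[of "r z"] by auto
    \<comment> \<open>The source of \<open>r z\<close> is seen on its first code word, a walk from
      the source of \<open>d (r z)\<close>.\<close>
    have "tail F (r z 0) = tail E (d (r z))"
      using code_awalk[OF rz(2)] code_nonempty[OF rz(2)]
      by (subst rz(3), cases "code (d (r z))") (auto simp: F.awalk_Cons_iff)
    then show ?thesis
      using dr[OF z] by simp
  qed
  have x: "x \<in> infinite_paths E"
    unfolding infinite_paths_def x_def using dr[OF r] head[OF r] by simp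
  \<comment> \<open>For \<open>n = Suc i\<close> the encoded part already covers entry
    \<open>i\<close>.\<close>
  have pre: "y = encode (prefix n x) \<frown> (r ^^ n) y" for n
  proof (induction n)
    case (Suc n)
    have "(r ^^ n) y = code (x n) \<frown> (r ^^ Suc n) y"
      using dr[OF r[of n]] by (simp add: x_def)
    moreover have "encode (prefix (Suc n) x) = encode (prefix n x) @ code (x n)"
      by simp
    ultimately show ?case
      using Suc by (metis conc_conc)
  qed simp
  have "lift x i = y i" for i
  proof -
    have "i < length (encode (prefix (Suc i) x))"
      using length_encode_prefix[OF x, of "Suc i"] by simp
    then show ?thesis
      unfolding lift_def using fun_cong[OF pre[of "Suc i"], of i] by simp
  qed
  then have "lift x = y"
    by blast
  then show ?thesis
    using x by blast
qed


section \<open>The integer component under coding\<close>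

text \<open>If \<open>x\<close> and \<open>y\<close> are tail equivalent with shift
  \<open>k\<close>, reading \<open>x\<close> up to \<open>n\<close> and \<open>y\<close> up to
  \<open>n - k\<close> reaches the same point of a common tail. From there on both encodings grow by
  the same edges and their lengths differ by a constant, which becomes the integer component of the
  image.\<close>

definition lag :: "'e word \<Rightarrow> int \<Rightarrow> 'e word \<Rightarrow> int \<Rightarrow> bool" where
  "lag x k y l \<longleftrightarrow>
     (\<forall>\<^sub>F n in sequentially.
        l = int (length (encode (prefix n x))) - int (length (encode (prefix (nat (int n - k)) y))))"

text \<open>Defined through \<open>lag\<close> rather than through a presentation by initial
  segments and a common tail, so independence of the presentation needs no separate proof.\<close>

definition groupoid_map :: "'e word \<times> int \<times> 'e word \<Rightarrow> 'f word \<times> int \<times> 'f word" where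
  "groupoid_map = (\<lambda>(x, k, y). (lift x, THE l. lag x k y l, lift y))"

lemma lag_unique:
  assumes "lag x k y l" "lag x k y l'"
  shows "l = l'"
proof -
  have "\<forall>\<^sub>F n in sequentially. l = l'"
    using eventually_conj[OF assms[unfolded lag_def]] by (rule eventually_mono) simp
  then show ?thesis
    by simp
qed

lemma The_lag: "lag x k y l \<Longrightarrow> (THE l. lag x k y l) = l"
  by (rule the_equality) (auto intro: lag_unique)

lemma lag_conc:
  "lag (as \<frown> z) (int (length as) - int (length bs)) (bs \<frown> z)
     (int (length (encode as)) - int (length (encode bs)))"
  unfolding lag_def eventually_sequentially
proof (intro exI allI impI)
  fix n assume n: "length as \<le> n"
  \<comment> \<open>Both prefixes then end with the same \<open>m\<close> edges of \<open>z\<close>,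
    whose encoding cancels in the difference.\<close>
  define m where "m = n - length as"
  have "nat (int n - (int (length as) - int (length bs))) = length bs + m" "n = length as + m"
    using n unfolding m_def by linarith+
  then show "int (length (encode as)) - int (length (encode bs)) =
      int (length (encode (prefix n (as \<frown> z)))) -
      int (length (encode (prefix (nat (int n - (int (length as) - int (length bs)))) (bs \<frown> z))))"
    by simp
qed

lemma filterlim_nat_diff: "filterlim (\<lambda>n. nat (int n - k)) sequentially sequentially"
  unfolding filterlim_at_top eventually_sequentially
proof
  fix m
  show "\<exists>n0. \<forall>n\<ge>n0. m \<le> nat (int n - k)"
    by (intro exI[of _ "m + nat k"] allI impI) linarith
qed

text \<open>Evaluating the second lag at \<open>n - k\<close> makes the encoded length for
  \<open>y\<close> cancel in the sum.\<close>

lemma lag_compose: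
  assumes "lag x k y a" "lag y l z b"
  shows "lag x (k + l) z (a + b)"
proof -
  \<comment> \<open>Beyond \<open>nat k\<close> the inner truncation is exact, so the two shifts add
    up.\<close>
  have "\<forall>\<^sub>F n in sequentially. n \<ge> nat k"
    by (rule eventually_ge_at_top)
  moreover note assms(1)[unfolded lag_def]
  moreover note eventually_compose_filterlim[OF assms(2)[unfolded lag_def] filterlim_nat_diff[of k]]
  ultimately show ?thesis
    unfolding lag_def
  proof eventually_elim
    case (elim n)
    have eq: "nat (int (nat (int n - k)) - l) = nat (int n - (k + l))"
      using elim(1) by linarith
    show ?case
      using elim(2,3) unfolding eq by linarith
  qed
qed

text \<open>Substituting \<open>n + k\<close> for \<open>n\<close> interchanges the two
  readings.\<close>

lemma lag_inverse:
  assumes "lag x k y a"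
  shows "lag y (- k) x (- a)"
proof -
  have "\<forall>\<^sub>F n in sequentially. n \<ge> nat (- k)"
    by (rule eventually_ge_at_top)
  moreover note
    eventually_compose_filterlim[OF assms[unfolded lag_def] filterlim_nat_diff[of "- k"]]
  ultimately show ?thesis
    unfolding lag_def
  proof eventually_elim
    case (elim n)
    have "nat (int (nat (int n - - k)) - k) = n"
      using elim(1) by linarith
    then show ?case
      using elim(2) by simp
  qed
qed

text \<open>Encoded prefixes of \<open>y\<close> grow strictly with each edge, so the encoded length
  determines the position \<open>n - k\<close>.\<close>

lemma lag_inj:
  assumes y: "y \<in> infinite_paths E" and "lag x k y a" "lag x k' y a"
  shows "k = k'"
proof -
  have "length (encode (prefix n y)) < length (encode (prefix (Suc n) y))" for n
    using code_nonempty E.infinite_paths_in_arcs[OF y] by simp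
  then have "strict_mono (\<lambda>n. length (encode (prefix n y)))"
    unfolding strict_mono_Suc_iff by blast
  from strict_mono_eq[OF this]
  have inj: "length (encode (prefix m y)) = length (encode (prefix n y)) \<Longrightarrow> m = n" for m n
    by blast
  have "\<forall>\<^sub>F n in sequentially. n \<ge> nat k + nat k'"
    by (rule eventually_ge_at_top)
  moreover note assms(2,3)[unfolded lag_def]
  ultimately have "\<forall>\<^sub>F n :: nat in sequentially. k = k'"
  proof eventually_elim
    case (elim n)
    have "length (encode (prefix (nat (int n - k)) y)) = length (encode (prefix (nat (int n - k')) y))"
      using elim(2,3) by linarith
    then have "nat (int n - k) = nat (int n - k')"
      by (rule inj)
    then show ?case
      using elim(1) by linarith
  qed
  then show ?thesis
    by simp
qed

section \<open>The bijection of the groupoids\<close>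

text \<open>The explicit formula for the map on a presented element, by which it is compared with
  cylinders.\<close>

lemma groupoid_map_conc:
  assumes "E.awalk u as (tail E (z 0))" "E.awalk w bs (tail E (z 0))" "z \<in> infinite_paths E"
  shows "groupoid_map (as \<frown> z, int (length as) - int (length bs), bs \<frown> z) =
    (encode as \<frown> lift z, int (length (encode as)) - int (length (encode bs)), encode bs \<frown> lift z)"
  using assms by (simp add: groupoid_map_def lift_conc E.infinite_paths_conc The_lag[OF lag_conc])

lemma carrier_lag:
  assumes "(x, k, y) \<in> path_groupoid_carrier E"
  obtains a where "lag x k y a" "groupoid_map (x, k, y) = (lift x, a, lift y)"
  using assms
proof (rule E.path_groupoid_carrierE)
  fix u as w bs z
  assume "x = as \<frown> z" "y = bs \<frown> z" "k = int (length as) - int (length bs)"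
  then have "lag x k y (int (length (encode as)) - int (length (encode bs)))"
    using lag_conc by simp
  then show thesis
    using that by (simp add: groupoid_map_def The_lag)
qed

lemma groupoid_map_in_carrier:
  assumes "g \<in> path_groupoid_carrier E"
  shows "groupoid_map g \<in> path_groupoid_carrier F"
proof -
  obtain x k y where g: "g = (x, k, y)"
    by (cases g)
  obtain u as w bs z where *:
    "E.awalk u as (tail E (z 0))" "E.awalk w bs (tail E (z 0))" "z \<in> infinite_paths E"
    "x = as \<frown> z" "y = bs \<frown> z" "k = int (length as) - int (length bs)"
    using assms unfolding g by (rule E.path_groupoid_carrierE)
  show ?thesis
    unfolding g * groupoid_map_conc[OF *(1-3)]
    using *(1-3) by (intro F.path_groupoid_carrierI) (auto simp: tail_lift
        intro: encode_awalk lift_in_infinite_paths)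
qed

text \<open>The two paths are recovered by \<open>lift_inj\<close>, the integer between them by
  \<open>lag_inj\<close>.\<close>

lemma groupoid_map_inj: "inj_on groupoid_map (path_groupoid_carrier E)"
proof (rule inj_onI)
  fix g h
  assume g: "g \<in> path_groupoid_carrier E" and h: "h \<in> path_groupoid_carrier E"
    and eq: "groupoid_map g = groupoid_map h"
  obtain x k y x' k' y' where gh: "g = (x, k, y)" "h = (x', k', y')"
    by (cases g, cases h)
  obtain a where a: "lag x k y a" "groupoid_map g = (lift x, a, lift y)"
    using carrier_lag g unfolding gh by metis
  obtain b where b: "lag x' k' y' b" "groupoid_map h = (lift x', b, lift y')"
    using carrier_lag h unfolding gh by metis
  have paths: "x \<in> infinite_paths E" "y \<in> infinite_paths E"
    "x' \<in> infinite_paths E" "y' \<in> infinite_paths E"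
    using g h by (auto simp: gh path_groupoid_carrier_def)
  then have "x = x'" "y = y'" "a = b"
    using eq a(2) b(2) lift_inj by (auto dest: inj_onD)
  then show "g = h"
    using lag_inj[OF paths(2) a(1)] b(1) by (simp add: gh)
qed

text \<open>
  Lengthening both initial segments by the same edges of the common tail, up to the next cut,
  makes both of them encodings.
\<close>

lemma decode_common_tail:
  assumes cs: "F.awalk u cs (tail F (z 0))" and ds: "F.awalk w ds (tail F (z 0))"
    and z: "z \<in> infinite_paths F"
  obtains as bs ps t where
    "E.awalk u as (tail E (t 0))" "E.awalk w bs (tail E (t 0))" "t \<in> infinite_paths E"
    "z = ps \<frown> lift t" "encode as = cs @ ps" "encode bs = ds @ ps"
proof -
  obtain i where i: "F.awalk (tail F (z 0)) (prefix (Suc i) z) (tail F (suffix (Suc i) z 0))"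
    "last (prefix (Suc i) z) \<notin> mid"
    using z by (rule infinite_path_split)
  obtain t where t: "t \<in> infinite_paths E" "suffix (Suc i) z = lift t"
    using lift_surj[OF F.infinite_paths_suffix[OF z]] by (metis imageE)
  define ps where "ps = prefix (Suc i) z"
  have ps: "F.awalk (tail F (z 0)) ps (tail E (t 0))" "ps \<noteq> []" "last ps \<notin> mid"
    using i t by (simp_all add: ps_def tail_lift del: subseq_to_Suc)
  obtain as where "E.awalk u as (tail E (t 0))" "encode as = cs @ ps"
    using decode[OF F.awalk_appendI[OF cs ps(1)]] ps by auto
  moreover obtain bs where "E.awalk w bs (tail E (t 0))" "encode bs = ds @ ps"
    using decode[OF F.awalk_appendI[OF ds ps(1)]] ps by auto
  moreover have "z = ps \<frown> lift t"
    unfolding ps_def t(2)[symmetric] by (rule prefix_suffix)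
  ultimately show thesis
    using that t(1) by blast
qed

lemma groupoid_map_image: "groupoid_map ` path_groupoid_carrier E = path_groupoid_carrier F"
proof (intro equalityI subsetI)
  fix h assume h: "h \<in> path_groupoid_carrier F"
  obtain x k y where xky: "h = (x, k, y)"
    by (cases h)
  obtain u cs w ds z where *:
    "F.awalk u cs (tail F (z 0))" "F.awalk w ds (tail F (z 0))" "z \<in> infinite_paths F"
    "x = cs \<frown> z" "y = ds \<frown> z" "k = int (length cs) - int (length ds)"
    using h unfolding xky by (rule F.path_groupoid_carrierE)
  obtain as bs ps t where t:
    "E.awalk u as (tail E (t 0))" "E.awalk w bs (tail E (t 0))" "t \<in> infinite_paths E"
    "z = ps \<frown> lift t" "encode as = cs @ ps" "encode bs = ds @ ps"
    using *(1-3) by (rule decode_common_tail)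
  \<comment> \<open>The same \<open>ps\<close> is appended to \<open>cs\<close> and
    \<open>ds\<close>, so the difference of lengths is unchanged.\<close>
  have "h = groupoid_map (as \<frown> t, int (length as) - int (length bs), bs \<frown> t)"
    by (simp add: xky * t groupoid_map_conc[OF t(1-3)])
  then show "h \<in> groupoid_map ` path_groupoid_carrier E"
    using E.path_groupoid_carrierI[OF t(1-3)] by blast
qed (use groupoid_map_in_carrier in blast)

section \<open>Cylinders and the homeomorphism\<close>

text \<open>Equality holds because \<open>lift\<close> is onto and preserves the source of a
  path.\<close>

lemma groupoid_map_cylinder:
  assumes "E.awalk u as v" "E.awalk w bs v"
  shows "groupoid_map ` cylinder E (u, as, v) (w, bs, v) =
    cylinder F (u, encode as, v) (w, encode bs, v)"
proof (intro equalityI subsetI)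
  fix h assume "h \<in> groupoid_map ` cylinder E (u, as, v) (w, bs, v)"
  then obtain z where "z \<in> infinite_paths E" "tail E (z 0) = v"
    "h = groupoid_map (as \<frown> z, int (length as) - int (length bs), bs \<frown> z)"
    by (auto simp: E.cylinder_eq)
  then show "h \<in> cylinder F (u, encode as, v) (w, encode bs, v)"
    using assms groupoid_map_conc[of u as z w bs] lift_in_infinite_paths tail_lift
    by (auto simp: F.cylinder_eq)
next
  fix h assume "h \<in> cylinder F (u, encode as, v) (w, encode bs, v)"
  then obtain y where y: "y \<in> infinite_paths F" "tail F (y 0) = v" and
    h: "h = (encode as \<frown> y, int (length (encode as)) - int (length (encode bs)), encode bs \<frown> y)"
    by (auto simp: F.cylinder_eq)
  obtain z where z: "z \<in> infinite_paths E" "y = lift z"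
    using lift_surj[OF y(1)] by blast
  then have v: "tail E (z 0) = v"
    using y tail_lift by simp
  then have "h = groupoid_map (as \<frown> z, int (length as) - int (length bs), bs \<frown> z)"
    using assms z h groupoid_map_conc[of u as z w bs] by simp
  then show "h \<in> groupoid_map ` cylinder E (u, as, v) (w, bs, v)"
    using z v unfolding E.cylinder_eq by blast
qed

text \<open>The segments defining \<open>V\<close> may stop inside a code word. Lengthening both to
  a cut of the common tail gives a smaller cylinder that is the image of a cylinder.\<close>

lemma groupoid_map_neighbourhood:
  assumes g: "g \<in> path_groupoid_carrier E" and V: "V \<in> F.cylinders" "groupoid_map g \<in> V"
  obtains U where "U \<in> E.cylinders" "g \<in> U" "groupoid_map ` U \<subseteq> V"
proof -
  obtain u cs v w ds where V_eq: "V = cylinder F (u, cs, v) (w, ds, v)"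
    and cs: "F.awalk u cs v" and ds: "F.awalk w ds v"
    using V(1) unfolding F.cylinders_eq by blast
  obtain z where z: "z \<in> infinite_paths F" "tail F (z 0) = v"
    and g_eq: "groupoid_map g = (cs \<frown> z, int (length cs) - int (length ds), ds \<frown> z)"
    using V(2) unfolding V_eq F.cylinder_eq by blast
  obtain as bs ps t where t:
    "E.awalk u as (tail E (t 0))" "E.awalk w bs (tail E (t 0))" "t \<in> infinite_paths E"
    "z = ps \<frown> lift t" "encode as = cs @ ps" "encode bs = ds @ ps"
    using decode_common_tail[of u cs z w ds] cs ds z by metis
  define U where "U = cylinder E (u, as, tail E (t 0)) (w, bs, tail E (t 0))"
  have "groupoid_map g = groupoid_map (as \<frown> t, int (length as) - int (length bs), bs \<frown> t)"
    by (simp add: g_eq t groupoid_map_conc[OF t(1-3)])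
  then have "g = (as \<frown> t, int (length as) - int (length bs), bs \<frown> t)"
    using groupoid_map_inj g E.path_groupoid_carrierI[OF t(1-3)] by (simp add: inj_on_eq_iff)
  then have "g \<in> U"
    using t(3) unfolding U_def E.cylinder_eq by blast
  moreover have "U \<in> E.cylinders"
    using t(1,2) unfolding U_def E.cylinders_eq by blast
  moreover have "groupoid_map ` U \<subseteq> V"
  proof
    fix h assume "h \<in> groupoid_map ` U"
    then obtain y where y: "y \<in> infinite_paths F" "tail F (y 0) = tail E (t 0)"
      and h: "h = ((cs @ ps) \<frown> y, int (length cs) - int (length ds), (ds @ ps) \<frown> y)"
      unfolding U_def groupoid_map_cylinder[OF t(1,2)] F.cylinder_eq t(5,6) by auto
    \<comment> \<open>Any path starting where \<open>t\<close> starts can be put after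
      \<open>ps\<close>, which keeps the smaller cylinder inside \<open>V\<close>.\<close>
    have "F.awalk v ps (tail F (y 0))"
      using z t(3,4) y(2) F.infinite_paths_conc_iff[of ps "lift t"] tail_lift by simp
    then have "ps \<frown> y \<in> infinite_paths F" "tail F ((ps \<frown> y) 0) = v"
      using y(1) F.infinite_paths_conc F.tail_conc_0 by blast+
    then show "h \<in> V"
      unfolding V_eq F.cylinder_eq h conc_conc[symmetric] by blast
  qed
  ultimately show thesis
    using that by blast
qed

text \<open>Images of cylinders are cylinders; preimages of cylinders are open because they contain
  a cylinder around each point.\<close>

lemma groupoid_map_homeomorphic:
  "homeomorphic_map (path_groupoid_topology E) (path_groupoid_topology F) groupoid_map"
  unfolding E.path_groupoid_topology_eq F.path_groupoid_topology_eq
proof (rule homeomorphic_map_generated)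
  fix U assume "U \<in> E.cylinders"
  then obtain u as v w bs
    where U: "U = cylinder E (u, as, v) (w, bs, v)" "E.awalk u as v" "E.awalk w bs v"
    unfolding E.cylinders_eq by blast
  then have "groupoid_map ` U = cylinder F (u, encode as, v) (w, encode bs, v)"
    using groupoid_map_cylinder by simp
  moreover have "F.awalk u (encode as) v" "F.awalk w (encode bs) v"
    using U(2,3) encode_awalk by blast+
  ultimately have "groupoid_map ` U \<in> F.cylinders"
    unfolding F.cylinders_eq by blast
  then show "openin (topology_generated_by F.cylinders) (groupoid_map ` U)"
    by (rule topology_generated_by_Basis)
next
  fix V assume V: "V \<in> F.cylinders"
  show "openin (topology_generated_by E.cylinders) {g \<in> \<Union>E.cylinders. groupoid_map g \<in> V}"
  proof (subst openin_subopen, intro ballI)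
    fix g assume "g \<in> {g \<in> \<Union>E.cylinders. groupoid_map g \<in> V}"
    then obtain U where "U \<in> E.cylinders" "g \<in> U" "groupoid_map ` U \<subseteq> V"
      using groupoid_map_neighbourhood V unfolding E.Union_cylinders by blast
    then show "\<exists>T. openin (topology_generated_by E.cylinders) T \<and> g \<in> T \<and>
        T \<subseteq> {g \<in> \<Union>E.cylinders. groupoid_map g \<in> V}"
      by (intro exI[of _ U]) (auto intro: topology_generated_by_Basis)
  qed
qed (simp_all only: E.Union_cylinders F.Union_cylinders groupoid_map_inj groupoid_map_image)

text \<open>Products and inverses reduce to \<open>lag_compose\<close> and
  \<open>lag_inverse\<close>; composability is reflected because \<open>lift\<close> is
  injective.\<close>

theorem path_groupoid_isomorphic: "top_groupoid_isomorphic (path_groupoid E) (path_groupoid F)"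
  unfolding top_groupoid_isomorphic_def top_groupoid_iso_def
proof (intro exI[of _ groupoid_map] conjI)
  show "bij_betw groupoid_map (gcarrier (path_groupoid E)) (gcarrier (path_groupoid F))"
    using groupoid_map_inj groupoid_map_image by (simp add: bij_betw_def path_groupoid_def)
  show "\<forall>g\<in>gcarrier (path_groupoid E). \<forall>h\<in>gcarrier (path_groupoid E).
      (g, h) \<in> gcomposable (path_groupoid E) \<longleftrightarrow>
      (groupoid_map g, groupoid_map h) \<in> gcomposable (path_groupoid F)"
  proof (intro ballI)
    fix g h
    assume "g \<in> gcarrier (path_groupoid E)" "h \<in> gcarrier (path_groupoid E)"
    moreover obtain x k y y' l z where gh: "g = (x, k, y)" "h = (y', l, z)"
      by (cases g, cases h)
    ultimately have c: "(x, k, y) \<in> path_groupoid_carrier E" "(y', l, z) \<in> path_groupoid_carrier E"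
      by (simp_all add: path_groupoid_def)
    then have "lift y = lift y' \<longleftrightarrow> y = y'"
      using lift_inj by (auto simp: path_groupoid_carrier_def inj_on_eq_iff)
    then show "(g, h) \<in> gcomposable (path_groupoid E) \<longleftrightarrow>
        (groupoid_map g, groupoid_map h) \<in> gcomposable (path_groupoid F)"
      using c groupoid_map_in_carrier[OF c(1)] groupoid_map_in_carrier[OF c(2)]
      by (simp add: gh path_groupoid_def groupoid_map_def)
  qed
  show "\<forall>(g, h)\<in>gcomposable (path_groupoid E).
      groupoid_map (gmult (path_groupoid E) g h) =
      gmult (path_groupoid F) (groupoid_map g) (groupoid_map h)"
  proof clarify
    fix x k y y' l z
    assume "((x, k, y), (y', l, z)) \<in> gcomposable (path_groupoid E)"
    then have c: "(x, k, y) \<in> path_groupoid_carrier E" "(y, l, z) \<in> path_groupoid_carrier E"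
      and y: "y' = y"
      by (auto simp: path_groupoid_def)
    obtain a where a: "lag x k y a"
      using c(1) by (rule carrier_lag)
    obtain b where b: "lag y l z b"
      using c(2) by (rule carrier_lag)
    show "groupoid_map (gmult (path_groupoid E) (x, k, y) (y', l, z)) =
        gmult (path_groupoid F) (groupoid_map (x, k, y)) (groupoid_map (y', l, z))"
      using The_lag[OF a] The_lag[OF b] The_lag[OF lag_compose[OF a b]]
      by (simp add: y path_groupoid_def groupoid_map_def)
  qed
  show "\<forall>g\<in>gcarrier (path_groupoid E).
      groupoid_map (ginv (path_groupoid E) g) = ginv (path_groupoid F) (groupoid_map g)"
  proof clarify
    fix x k y
    assume "(x, k, y) \<in> gcarrier (path_groupoid E)"
    then have "(x, k, y) \<in> path_groupoid_carrier E"
      by (simp add: path_groupoid_def)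
    then obtain a where a: "lag x k y a"
      by (rule carrier_lag)
    show "groupoid_map (ginv (path_groupoid E) (x, k, y)) =
        ginv (path_groupoid F) (groupoid_map (x, k, y))"
      using The_lag[OF a] The_lag[OF lag_inverse[OF a]]
      by (simp add: path_groupoid_def groupoid_map_def)
  qed
  show "homeomorphic_map (gtopology (path_groupoid E)) (gtopology (path_groupoid F)) groupoid_map"
    using groupoid_map_homeomorphic by (simp add: path_groupoid_def)
qed

end


section \<open>Primitive transfers\<close>

text \<open>The matrix equations restated for arcs. \<open>arcs_K\<close> and \<open>arcs_M\<close>
  express that the summands of row \<open>p\<close> have disjoint supports.\<close>

locale row_transfer = E: nomulti_digraph E + F: nomulti_digraph F
  for E :: "('v, 'e) pre_digraph" and F :: "('v, 'f) pre_digraph" +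
  fixes p :: 'v and K M :: "'v set"
  assumes verts_eq: "verts F = verts E"
    and p_notin: "p \<notin> M" and disjoint: "K \<inter> M = {}"
    and arcs_other: "v \<noteq> p \<Longrightarrow> (v, w) \<in> arcs_ends F \<longleftrightarrow> (v, w) \<in> arcs_ends E"
    and arcs_F: "(p, w) \<in> arcs_ends F \<longleftrightarrow> w \<in> K \<union> M"
    and arcs_E: "(p, w) \<in> arcs_ends E \<longleftrightarrow> w \<in> K \<or> (\<exists>m\<in>M. (m, w) \<in> arcs_ends E)"
    and arcs_K: "w \<in> K \<Longrightarrow> m \<in> M \<Longrightarrow> (m, w) \<notin> arcs_ends E"
    and arcs_M:
      "m \<in> M \<Longrightarrow> m' \<in> M \<Longrightarrow> (m, w) \<in> arcs_ends E \<Longrightarrow> (m', w) \<in> arcs_ends E \<Longrightarrow> m = m'"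
begin

definition F_arc :: "'v \<Rightarrow> 'v \<Rightarrow> 'f" where
  "F_arc v w = (SOME f. f \<in> arcs F \<and> tail F f = v \<and> head F f = w)"

definition via :: "'v \<Rightarrow> 'v" where
  "via w = (SOME m. m \<in> M \<and> (m, w) \<in> arcs_ends E)"

definition code :: "'e \<Rightarrow> 'f list" where
  "code e =
     (if tail E e = p \<and> head E e \<notin> K
      then [F_arc p (via (head E e)), F_arc (via (head E e)) (head E e)]
      else [F_arc (tail E e) (head E e)])"

text \<open>The edges after which a code word is still incomplete; since \<open>p\<close> is not in
  \<open>M\<close>, no two of them are consecutive in a path.\<close>

definition mid :: "'f set" where
  "mid = {f \<in> arcs F. tail F f = p \<and> head F f \<in> M}"

lemma F_arc:
  assumes "(v, w) \<in> arcs_ends F"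
  shows "F_arc v w \<in> arcs F \<and> tail F (F_arc v w) = v \<and> head F (F_arc v w) = w"
  unfolding F_arc_def by (rule someI_ex) (use assms in \<open>auto simp: arcs_ends_conv\<close>)

lemma F_arc_eq: "f \<in> arcs F \<Longrightarrow> F_arc (tail F f) (head F f) = f"
  using F_arc[of "tail F f" "head F f"] F.no_multi_arcs
  by (auto simp: arcs_ends_conv arc_to_ends_def)

lemma via:
  assumes "(p, w) \<in> arcs_ends E" "w \<notin> K"
  shows "via w \<in> M \<and> (via w, w) \<in> arcs_ends E"
  unfolding via_def by (rule someI_ex) (use assms arcs_E in blast)

lemma via_eq: "m \<in> M \<Longrightarrow> (m, w) \<in> arcs_ends E \<Longrightarrow> via w = m"
  using via arcs_E arcs_K arcs_M by metis

text \<open>The second edge of a long word starts in \<open>M\<close>, hence not at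
  \<open>p\<close>. A short word starts away from \<open>p\<close> or ends in \<open>K\<close>.
  Either way the last edge avoids \<open>mid\<close>.\<close>

lemma code_cases:
  assumes e: "e \<in> arcs E"
  obtains
    (short) f where "code e = [f]" "f \<in> arcs F" "tail F f = tail E e" "head F f = head E e" "f \<notin> mid"
  | (long) f g where "code e = [f, g]" "f \<in> arcs F" "g \<in> arcs F" "tail F f = tail E e"
      "head F f = tail F g" "head F g = head E e" "f \<in> mid" "g \<notin> mid"
proof (cases "tail E e = p \<and> head E e \<notin> K")
  case True
  have ends: "(tail E e, head E e) \<in> arcs_ends E"
    using e by (auto simp: arcs_ends_conv)
  then have m: "via (head E e) \<in> M" "(via (head E e), head E e) \<in> arcs_ends E"
    using via True by auto
  \<comment> \<open>The first arc comes from the new row \<open>p\<close>; the second survives from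
    \<open>E\<close> because \<open>via (head E e)\<close> differs from \<open>p\<close>.\<close>
  then have "(p, via (head E e)) \<in> arcs_ends F" "(via (head E e), head E e) \<in> arcs_ends F"
    using arcs_F arcs_other p_notin by (blast, metis)
  from F_arc[OF this(1)] F_arc[OF this(2)] show thesis
    using True m(1) p_notin by (intro long) (auto simp: code_def mid_def)
next
  case False
  have ends: "(tail E e, head E e) \<in> arcs_ends E"
    using e by (auto simp: arcs_ends_conv)
  then have "(tail E e, head E e) \<in> arcs_ends F"
    using False arcs_F arcs_other by (cases "tail E e = p") auto
  from F_arc[OF this] show thesis
    using False disjoint by (intro short) (auto simp: code_def mid_def)
qed

lemma code_awalk:
  assumes e: "e \<in> arcs E"
  shows "pre_digraph.awalk F (tail E e) (code e) (head E e)"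
  using e E.head_in_verts[OF e]
  by (cases rule: code_cases) (auto simp: F.awalk_simps verts_eq simp del: E.head_in_verts)

text \<open>A first edge outside \<open>mid\<close> is a code word by itself. A first edge in
  \<open>mid\<close> cannot be the last one, and together with its successor it codes an edge from
  \<open>p\<close>.\<close>

lemma code_parse:
  assumes "pre_digraph.awalk F u as v" "as \<noteq> []" "last as \<notin> mid"
  shows "\<exists>e\<in>arcs E. \<exists>bs. as = code e @ bs"
proof -
  obtain f cs where as: "as = f # cs"
    using assms(2) by (cases as) auto
  have f: "f \<in> arcs F" and cs: "pre_digraph.awalk F (head F f) cs v"
    using assms(1) by (auto simp: as F.awalk_Cons_iff)
  have f_ends: "(tail F f, head F f) \<in> arcs_ends F"
    using f by (auto simp: arcs_ends_conv)
  show ?thesis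
  proof (cases "f \<in> mid")
    case False
    then have K: "tail F f = p \<Longrightarrow> head F f \<in> K"
      using f f_ends arcs_F by (auto simp: mid_def)
    then have "(tail F f, head F f) \<in> arcs_ends E"
      using f_ends arcs_E arcs_other by (cases "tail F f = p") auto
    then obtain e where "e \<in> arcs E" "tail E e = tail F f" "head E e = head F f"
      by (auto simp: arcs_ends_conv)
    then show ?thesis
      using K F_arc_eq[OF f] by (intro bexI[of _ e] exI[of _ cs]) (auto simp: as code_def)
  next
    case True
    then have m: "tail F f = p" "head F f \<in> M"
      by (auto simp: mid_def)
    obtain g ds where cs_eq: "cs = g # ds"
      using assms(3) True as by (cases cs) auto
    have g: "g \<in> arcs F" "tail F g = head F f"
      using cs by (auto simp: cs_eq F.awalk_Cons_iff)
    have "(head F f, head F g) \<in> arcs_ends F"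
      using g by (force simp: arcs_ends_conv)
    then have mg: "(head F f, head F g) \<in> arcs_ends E"
      using arcs_other m p_notin by metis
    then have "(p, head F g) \<in> arcs_ends E" "head F g \<notin> K"
      using arcs_E arcs_K m by blast+
    then obtain e where "e \<in> arcs E" "tail E e = p" "head E e = head F g" "head E e \<notin> K"
      by (auto simp: arcs_ends_conv)
    then show ?thesis
      using via_eq[OF m(2) mg] F_arc_eq[OF f] F_arc_eq[OF g(1)] m(1) g(2)
      by (intro bexI[of _ e] exI[of _ ds]) (auto simp: as cs_eq code_def)
  qed
qed

lemma path_code: "path_code E F code mid"
proof unfold_locales
  show "inj_on code (arcs E)"
  proof (rule inj_onI)
    fix e e' assume e: "e \<in> arcs E" "e' \<in> arcs E" "code e = code e'"
    have "code e \<noteq> []"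
      by (simp add: code_def)
    \<comment> \<open>The walk \<open>code e\<close> has the ends of \<open>e\<close>, and its
      nonempty edge list determines them.\<close>
    then have "tail E e = tail E e' \<and> head E e = head E e'"
      using F.awalk_ends[OF code_awalk[OF e(1)]] code_awalk[OF e(2)] e(3) by metis
    then show "e = e'"
      using E.no_multi_arcs e by (simp add: arc_to_ends_def)
  qed
  show "set (butlast (code e)) \<subseteq> mid" "last (code e) \<notin> mid" if "e \<in> arcs E" for e
    using that by (cases rule: code_cases; simp)+
  show "\<exists>i. y i \<notin> mid" if "y \<in> infinite_paths F" for y
  proof (cases "y 0 \<in> mid")
    case True
    have "head F (y 0) = tail F (y 1)"
      using that by (simp add: infinite_paths_def)
    then have "y 1 \<notin> mid"
      using True p_notin by (auto simp: mid_def)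
    then show ?thesis
      by blast
  qed blast
qed (use verts_eq code_awalk code_parse in \<open>auto simp: code_def\<close>)

end

section \<open>From vertex matrices to arcs\<close>

lemma (in nomulti_digraph) vertex_matrix_eq:
  "vertex_matrix G v w = (if (v, w) \<in> arcs_ends G then 1 else 0)"
proof (cases "(v, w) \<in> arcs_ends G")
  case True
  then obtain e where "e \<in> arcs G" "tail G e = v" "head G e = w"
    by (auto simp: arcs_ends_conv)
  then have "{e \<in> arcs G. tail G e = v \<and> head G e = w} = {e}"
    using no_multi_arcs by (auto simp: arc_to_ends_def)
  then show ?thesis
    using True by (simp add: vertex_matrix_def)
next
  case False
  then have "{e \<in> arcs G. tail G e = v \<and> head G e = w} = {}"
    by (auto simp: arcs_ends_conv)
  then show ?thesis
    using False by (simp only: vertex_matrix_def card.empty if_False)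
qed

text \<open>The entries of row \<open>p\<close> are at most 1, so at each column at most one summand
  of the row equation is nonzero; this yields both disjointness conditions.\<close>

lemma graph_primitive_transfer_row_transfer:
  assumes "nomulti_digraph E" "nomulti_digraph F" "graph_primitive_transfer E F"
  shows "\<exists>p K M. row_transfer E F p K M"
proof -
  interpret E: nomulti_digraph E by fact
  interpret F: nomulti_digraph F by fact
  define V where "V = verts E"
  have V: "verts F = V"
    using assms(3) by (simp add: graph_primitive_transfer_def V_def)
  have E_verts: "v \<in> V" "w \<in> V" if "(v, w) \<in> arcs_ends E" for v w
    using that by (auto simp: arcs_ends_conv V_def)
  have F_verts: "v \<in> V" "w \<in> V" if "(v, w) \<in> arcs_ends F" for v w
    using that by (auto simp: arcs_ends_conv V[symmetric])
  obtain p where "primitive_transfer_at V (vertex_matrix E) (vertex_matrix F) p"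
    using assms(3) by (auto simp: graph_primitive_transfer_def matrix_primitive_transfer_def V_def)
  then obtain K M where fin: "finite K" "finite M" and sub: "K \<subseteq> V" "M \<subseteq> V"
    and disj: "K \<inter> M = {}" "p \<notin> M"
    and row: "\<forall>j\<in>V.
      vertex_matrix E p j = (\<Sum>k\<in>K. unit_row k j) + (\<Sum>m\<in>M. vertex_matrix E m j)"
    and other: "\<forall>i\<in>V - {p}. \<forall>j\<in>V. vertex_matrix F i j = vertex_matrix E i j"
    and row_F: "\<forall>j\<in>V. vertex_matrix F p j = (if j \<in> K \<union> M then 1 else 0)"
    unfolding primitive_transfer_at_def by (elim conjE exE) (rule that)
  \<comment> \<open>The predecessors of \<open>w\<close> in \<open>M\<close>; the sum over
    \<open>M\<close> in the row equation counts them.\<close>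
  define N where "N w = {m \<in> M. (m, w) \<in> arcs_ends E}" for w
  have N: "(if (p, w) \<in> arcs_ends E then 1 else 0) = (if w \<in> K then 1 else 0) + card (N w)"
    if "w \<in> V" for w
  proof -
    have "(\<Sum>k\<in>K. unit_row k w) = (if w \<in> K then 1 else 0)"
      using fin(1) by (simp add: unit_row_def)
    moreover have "(\<Sum>m\<in>M. vertex_matrix E m w) = card (N w)"
      using fin(2) by (simp add: E.vertex_matrix_eq N_def sum.If_cases Int_def)
    ultimately show ?thesis
      using bspec[OF row that] by (simp add: E.vertex_matrix_eq)
  qed
  have finN: "finite (N w)" for w
    using fin(2) by (simp add: N_def)
  have "row_transfer E F p K M"
  proof unfold_locales
    fix v w
    show "(v, w) \<in> arcs_ends F \<longleftrightarrow> (v, w) \<in> arcs_ends E" if "v \<noteq> p"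
    \<comment> \<open>The matrices are compared on \<open>V\<close> only; outside \<open>V\<close>
      neither graph has arcs.\<close>
    proof (cases "v \<in> V \<and> w \<in> V")
      case True
      then show ?thesis
        using bspec[OF bspec[OF other, of v], of w] that by (simp add: E.vertex_matrix_eq F.vertex_matrix_eq split: if_splits)
    next
      case False
      then show ?thesis
        using E_verts F_verts by blast
    qed
    show "(p, w) \<in> arcs_ends F \<longleftrightarrow> w \<in> K \<union> M"
    proof (cases "w \<in> V")
      case True
      then show ?thesis
        using bspec[OF row_F, of w] by (simp add: F.vertex_matrix_eq split: if_splits)
    next
      case False
      then show ?thesis
        using F_verts sub by blast
    qed
    show "(p, w) \<in> arcs_ends E \<longleftrightarrow> w \<in> K \<or> (\<exists>m\<in>M. (m, w) \<in> arcs_ends E)"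
    proof (cases "w \<in> V")
      case True
      have "card (N w) = 0 \<longleftrightarrow> \<not> (\<exists>m\<in>M. (m, w) \<in> arcs_ends E)"
        using finN by (auto simp: N_def)
      then show ?thesis
        using N[OF True] by (auto split: if_splits)
    next
      case False
      then show ?thesis
        using E_verts sub by blast
    qed
    show "(m, w) \<notin> arcs_ends E" if "w \<in> K" "m \<in> M" for m
    proof -
      have "card (N w) = 0"
        using N[of w] that sub by (auto split: if_splits)
      then show ?thesis
        using finN that by (auto simp: N_def)
    qed
    show "m = m'" if "m \<in> M" "m' \<in> M" "(m, w) \<in> arcs_ends E" "(m', w) \<in> arcs_ends E" for m m'
    proof -
      have "card (N w) \<le> Suc 0"
        using N[of w] E_verts[OF that(3)] by (auto split: if_splits)
      then show ?thesis
        using that card_le_Suc0_iff_eq[OF finN] by (auto simp: N_def)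
    qed
  qed (use V disj in \<open>simp_all add: V_def\<close>)
  then show ?thesis
    by blast
qed

theorem proposition3p8:
  fixes E :: "('v, 'e) pre_digraph" and F :: "('v, 'f) pre_digraph"
  assumes "directed_graph E" and "directed_graph F"
    and "row_finite E"
    and "graph_primitive_transfer E F"
  shows "top_groupoid_isomorphic (path_groupoid E) (path_groupoid F)"
proof -
  obtain p K M where "row_transfer E F p K M"
    using assms graph_primitive_transfer_row_transfer unfolding directed_graph_def by blast
  then interpret row_transfer E F p K M .
  interpret path_code E F code mid
    by (rule path_code)
  show ?thesis
    by (rule path_groupoid_isomorphic)
qed

end
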